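(* Let $\ell\geq0$ be an integer and let $f:[0,1]\to\mathbb{R}$ be a continuous function that is $C^{\ell+4}$ on an open subset $\Omega\subset(0,1)$. Let $K\subset\Omega$ be a compact set. Then there exists a constant $C_{f,K,\ell}>0$ such that $$|B_{\nu}(f)^{(\ell)}(x)-f^{(\ell)}(x)|\leq\frac{1}{2\nu}\Big(\ell(\ell-1)\sum_{k=\ell}^{\ell+3}\frac{\|f^{(k)}\|_K}{(k-\ell)!}+\ell|1-2x|\sum_{k=\ell+1}^{\ell+3}\frac{\|f^{(k)}\|_K}{(k-\ell-1)!}+x(1-x)\sum_{k=\ell+2}^{\ell+3}\frac{\|f^{(k)}\|_K}{(k-\ell-2)!}\Big)+\frac{C_{f,K,\ell}}{\nu^2}$$ for each $x\in K$ and each integer $\nu\geq1$. In addition, for each $\varepsilon>0$ there exists a constant $C^*_{f,K,\ell,\varepsilon}>0$ such that $$\Big|\nu\big(B_{\nu}(f)^{(\ell)}(x)-f^{(\ell)}(x)\big)-\frac{1}{2}\frac{d^\ell}{dx^\ell}\big(x(1-x)f''(x)\big)\Big|<\varepsilon+\frac{C^*_{f,K,\ell,\varepsilon}}{\nu}$$ for each $x\in K$ and each integer $\nu>\ell$.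
   Context: For a function $f:[0,1]\to\mathbb{R}$ and an integer $\nu\geq1$, the Bernstein polynomial of $f$ of degree $\nu$ is $$B_\nu(f)(x):=\sum_{k=0}^\nu f\Big(\frac{k}{\nu}\Big)\binom{\nu}{k}x^k(1-x)^{\nu-k},$$ and $B_\nu(f)^{(\ell)}$ denotes its $\ell$-th derivative. For a compact set $K$ and a continuous function $h$ on $K$, $\|h\|_K:=\max\{|h(x)|:x\in K\}$. The constants depend only on the data in their subindices (in particular not on $\nu$ or $x$). *)

theory Defs
  imports "HOL-Analysis.Analysis"
begin

text \<open>
  A function on the unit interval is represented by a total function of type
  \<open>real \<Rightarrow> real\<close>; only its values on \<open>{0..1}\<close> matter below. The derivative of order \<open>k\<close>
  is the iterated derivative \<open>(deriv ^^ k) f\<close>. It is only used at interior points,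
  where it does not depend on the values outside the interval.
\<close>

definition Bernstein_poly :: "nat \<Rightarrow> (real \<Rightarrow> real) \<Rightarrow> real \<Rightarrow> real" where
  "Bernstein_poly n f x = (\<Sum>k\<le>n. f (real k / real n) * Bernstein n k x)"

text \<open>
  Class \<open>C\<^sup>m\<close>, intended for open \<open>S\<close>. Differentiability is required explicitly because
  \<^const>\<open>deriv\<close> is an unspecified value where no derivative exists.
\<close>

definition Cm_on :: "nat \<Rightarrow> (real \<Rightarrow> real) \<Rightarrow> real set \<Rightarrow> bool" where
  "Cm_on m f S \<longleftrightarrow>
     (\<forall>k<m. \<forall>x\<in>S. (deriv ^^ k) f differentiable (at x)) \<and>
     (\<forall>k\<le>m. continuous_on S ((deriv ^^ k) f))"

text \<open>
  For \<open>h\<close> continuous on a nonempty compact \<open>K\<close> the supremum is attained, so it is the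
  maximum of \<open>\<bar>h\<bar>\<close> on \<open>K\<close>. It is unspecified for empty \<open>K\<close>.
\<close>

definition max_norm_on :: "real set \<Rightarrow> (real \<Rightarrow> real) \<Rightarrow> real" where
  "max_norm_on K h = (SUP x\<in>K. \<bar>h x\<bar>)"

end

theory Submission
  imports Defs "HOL-Computational_Algebra.Polynomial"
begin

text \<open>
  Both claims follow from one uniform expansion with a quantitative error
  (\<open>bernstein_derivative_expansion\<close>): on \<open>K\<close>, the derivative of order \<open>l\<close> of the Bernstein
  polynomial differs from that of \<open>f + x(1 - x) f'' / (2 n)\<close> by at most \<open>C/n\<^sup>2\<close>. Multiplied by
  \<open>n\<close>, it gives the second claim. For the first one, the derivative of order \<open>l\<close> of \<open>x(1 - x) f''\<close>
  is \<open>x(1 - x) f^(l+2) + l (1 - 2 x) f^(l+1) - l (l - 1) f^(l)\<close>, and each of the three terms is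
  bounded by one summand of the corresponding sum of norms.

  The source of the expansion is the equation \<open>x(1 - x) b' = (k - n x) b\<close> of the basis
  polynomials \<open>b\<close>. Fix a point \<open>y\<close> of \<open>K\<close> and split \<open>f\<close> into its Taylor polynomial of
  degree \<open>l + 3\<close> at \<open>y\<close> and a remainder. By compactness the remainder is at most \<open>M \<bar>t - y\<bar>^(l + 4)\<close>
  on the whole unit interval with \<open>M\<close> independent of \<open>y\<close> (\<open>uniform_taylor_remainder\<close>); far from
  \<open>y\<close>, where \<open>f\<close> may be merely continuous, this only says that it is bounded.

  For polynomials, the equation shows how the operator behaves under multiplication by
  \<open>x - y\<close>. The resulting recursion (\<open>voronovskaya_defect_shift\<close>) gives the expansion with an
  error of order \<open>1/n\<^sup>2\<close> in the coefficients, hence for all derivatives at once.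

  For the remainder, the equation writes \<open>(x(1 - x))^l b^(l)\<close> as \<open>b\<close> times a polynomial in \<open>n\<close>,
  \<open>k - n x\<close> and \<open>x\<close> (\<open>higher_pderiv_basis_symbol\<close>). Giving weight 2 to \<open>n\<close> and weight 1
  to \<open>k - n x\<close>, this factor has weight \<open>l\<close> and is bounded by a multiple of
  \<open>(sqrt n + \<bar>k - n x\<bar>)^l\<close>. Combined with the bound on the
  remainder it leads to a central moment of even order \<open>2 (l + 2)\<close>, which is of size
  \<open>n^(l + 2)\<close>; division by \<open>n^(l + 4)\<close> leaves \<open>1/n\<^sup>2\<close> (\<open>remainder_estimate\<close>). The factor
  \<open>(x(1 - x))^l\<close> is harmless because \<open>K\<close> is a compact subset of the open unit interval.
\<close>

section \<open>Bernstein polynomials as formal polynomials\<close>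

definition variance_poly :: "real poly" where
  "variance_poly = [:0, 1, -1:]"

text \<open>
  The Bernstein polynomials are treated as formal polynomials, so that their derivatives of all
  orders are algebraic objects and identities between them can be differentiated freely.
\<close>

definition basis_poly :: "nat \<Rightarrow> nat \<Rightarrow> real poly" where
  "basis_poly n k = smult (real (n choose k)) ([:0, 1:] ^ k * [:1, -1:] ^ (n - k))"

definition bern_op :: "nat \<Rightarrow> (real \<Rightarrow> real) \<Rightarrow> real poly" where
  "bern_op n g = (\<Sum>k\<le>n. smult (g (real k / real n)) (basis_poly n k))"

lemma poly_variance_poly: "poly variance_poly x = x * (1 - x)"
  by (simp add: variance_poly_def algebra_simps)

lemma poly_basis_poly: "poly (basis_poly n k) x = Bernstein n k x"
  by (simp add: basis_poly_def Bernstein_def algebra_simps)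

lemma Bernstein_poly_eq_poly: "Bernstein_poly n f = poly (bern_op n f)"
  by (simp add: Bernstein_poly_def bern_op_def poly_sum poly_basis_poly fun_eq_iff)

lemma sum_basis_poly: "(\<Sum>k\<le>n. basis_poly n k) = 1"
  by (rule poly_eq_poly_eq_iff[THEN iffD1]) (simp add: fun_eq_iff poly_sum poly_basis_poly)

text \<open>
  The first-order differential equation of the basis polynomials. Everything that follows about
  the operator comes from it: differentiation is traded for multiplication by the deviation
  \<open>k - n x\<close>.
\<close>

lemma variance_times_pderiv_basis:
  assumes "k \<le> n"
  shows "variance_poly * pderiv (basis_poly n k) = [:real k, - real n:] * basis_poly n k"
proof (rule poly_eq_poly_eq_iff[THEN iffD1], rule ext)
  fix x :: real
  have lower: "real k * x ^ (k - 1) * x = real k * x ^ k" for k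
    by (cases k) simp_all
  have upper: "real m * (1 - x) ^ (m - 1) * (1 - x) = real m * (1 - x) ^ m" for m
    by (cases m) simp_all
  have "((\<lambda>x. real (n choose k) * (x ^ k * (1 - x) ^ (n - k))) has_real_derivative
      real (n choose k) * (real k * x ^ (k - 1) * (1 - x) ^ (n - k)
        - x ^ k * (real (n - k) * (1 - x) ^ (n - k - 1)))) (at x)"
    by (auto intro!: derivative_eq_intros)
  moreover have "(\<lambda>x. real (n choose k) * (x ^ k * (1 - x) ^ (n - k))) = poly (basis_poly n k)"
    by (simp add: fun_eq_iff poly_basis_poly Bernstein_def)
  ultimately have D: "poly (pderiv (basis_poly n k)) x =
      real (n choose k) * (real k * x ^ (k - 1) * (1 - x) ^ (n - k)
        - x ^ k * (real (n - k) * (1 - x) ^ (n - k - 1)))"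
    using DERIV_unique poly_DERIV by metis
  have "x * (1 - x) * poly (pderiv (basis_poly n k)) x = real (n choose k) *
      ((real k * x ^ (k - 1) * x) * (1 - x) ^ (n - k) * (1 - x)
        - x ^ k * x * (real (n - k) * (1 - x) ^ (n - k - 1) * (1 - x)))"
    unfolding D by (simp only: algebra_simps)
  also have "\<dots> = real (n choose k) * x ^ k * (1 - x) ^ (n - k)
      * (real k * (1 - x) - real (n - k) * x)"
    unfolding lower upper by (simp only: algebra_simps)
  also have "real k * (1 - x) - real (n - k) * x = real k - real n * x"
    using assms by (simp add: of_nat_diff algebra_simps)
  finally show "poly (variance_poly * pderiv (basis_poly n k)) x
      = poly ([:real k, - real n:] * basis_poly n k) x"
    unfolding poly_mult poly_variance_poly poly_basis_poly Bernstein_def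
    by (simp add: algebra_simps)
qed

lemma smult_sum_right: "smult (c::real) (sum f A) = (\<Sum>x\<in>A. smult c (f x))"
  by (induction A rule: infinite_finite_induct) (simp_all add: smult_add_right)

lemma bern_op_add: "bern_op n (\<lambda>t. g t + h t) = bern_op n g + bern_op n h"
  by (simp add: bern_op_def smult_add_left sum.distrib)

lemma bern_op_cmult: "bern_op n (\<lambda>t. c * g t) = smult c (bern_op n g)"
  by (simp add: bern_op_def smult_sum_right)

lemma bern_op_const_1: "bern_op n (\<lambda>t. 1) = 1"
  by (simp add: bern_op_def sum_basis_poly)

lemma pderiv_sum_poly: "pderiv (sum f A) = (\<Sum>x\<in>A. pderiv (f x))"
  by (induction A rule: infinite_finite_induct) (simp_all add: pderiv_add)

text \<open>
  Write \<open>k/n - y = (x - y) + (k - n x)/n\<close>; the second summand is turned into a derivative by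
  the differential equation of the basis.
\<close>

lemma bern_op_shift:
  assumes "n \<ge> 1"
  shows "bern_op n (\<lambda>t. (t - y) * g t)
    = [:- y, 1:] * bern_op n g + smult (1 / real n) (variance_poly * pderiv (bern_op n g))"
proof -
  have step: "smult ((real k / real n - y) * c) (basis_poly n k)
      = [:- y, 1:] * smult c (basis_poly n k)
        + smult (1 / real n) (variance_poly * pderiv (smult c (basis_poly n k)))"
    if "k \<le> n" for k c
  proof -
    have "smult (1 / real n) (variance_poly * pderiv (smult c (basis_poly n k)))
        = smult (c / real n) ([:real k, - real n:] * basis_poly n k)"
      by (simp only: pderiv_smult mult_smult_right smult_smult
        variance_times_pderiv_basis[OF that]) simp
    moreover have "smult ((real k / real n - y) * c) (basis_poly n k)
      = [:- y, 1:] * smult c (basis_poly n k)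
        + smult (c / real n) ([:real k, - real n:] * basis_poly n k)"
      using assms
      by (intro poly_eq_poly_eq_iff[THEN iffD1] ext) (simp add: field_simps)
    ultimately show ?thesis by simp
  qed
  have "bern_op n (\<lambda>t. (t - y) * g t)
      = (\<Sum>k\<le>n. [:- y, 1:] * smult (g (real k / real n)) (basis_poly n k)
        + smult (1 / real n) (variance_poly
            * pderiv (smult (g (real k / real n)) (basis_poly n k))))"
    unfolding bern_op_def by (intro sum.cong refl step) simp
  also have "\<dots> = [:- y, 1:] * bern_op n g
      + smult (1 / real n) (variance_poly * pderiv (bern_op n g))"
    unfolding bern_op_def pderiv_sum_poly
    by (simp only: sum.distrib sum_distrib_left smult_sum_right)
  finally show ?thesis .
qed

section \<open>Voronovskaya's expansion of polynomials\<close>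

text \<open>
  The error of Voronovskaya's two-term expansion of the operator on polynomials, which is of
  size \<open>1/n\<^sup>2\<close>.
\<close>

definition voronovskaya_defect :: "nat \<Rightarrow> real poly \<Rightarrow> real poly" where
  "voronovskaya_defect n p = bern_op n (poly p) - p
     - smult (1 / (2 * real n)) (variance_poly * pderiv (pderiv p))"

lemma voronovskaya_defect_1: "voronovskaya_defect n 1 = 0"
proof -
  have "poly (1 :: real poly) = (\<lambda>t. 1)"
    by (simp add: fun_eq_iff)
  then show ?thesis
    by (simp add: voronovskaya_defect_def bern_op_const_1)
qed

lemma voronovskaya_defect_add:
  "voronovskaya_defect n (p + r) = voronovskaya_defect n p + voronovskaya_defect n r"
proof -
  have "bern_op n (poly (p + r)) = bern_op n (poly p) + bern_op n (poly r)"
    unfolding bern_op_add[symmetric] by (rule arg_cong[where f = "bern_op n"]) (simp add: fun_eq_iff)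
  then show ?thesis
    by (simp add: voronovskaya_defect_def pderiv_add distrib_left smult_add_right)
qed

lemma voronovskaya_defect_smult:
  "voronovskaya_defect n (smult c p) = smult c (voronovskaya_defect n p)"
proof -
  have "bern_op n (poly (smult c p)) = smult c (bern_op n (poly p))"
    unfolding bern_op_cmult[symmetric] by (rule arg_cong[where f = "bern_op n"]) (simp add: fun_eq_iff)
  then show ?thesis
    by (simp add: voronovskaya_defect_def pderiv_smult smult_diff_right mult.commute)
qed

lemma voronovskaya_defect_sum:
  "voronovskaya_defect n (\<Sum>m\<in>A. smult (c m) (p m))
    = (\<Sum>m\<in>A. smult (c m) (voronovskaya_defect n (p m)))"
proof (induction A rule: infinite_finite_induct)
  case (insert m A)
  then show ?case
    by (simp add: voronovskaya_defect_add voronovskaya_defect_smult)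
qed (use voronovskaya_defect_smult[of n 0 0] in simp_all)

text \<open>
  The terms of order \<open>1/n\<close> cancel: \<open>x(1 - x) p'/n\<close> comes once from the shift rule of
  the operator and once from \<open>((x - y) p)'' = (x - y) p'' + 2 p'\<close>. This makes the quadratic
  decay of the defect an induction on powers of \<open>x - y\<close>.
\<close>

lemma voronovskaya_defect_shift:
  assumes "n \<ge> 1"
  shows "voronovskaya_defect n ([:- y, 1:] * p)
    = [:- y, 1:] * voronovskaya_defect n p
      + smult (1 / real n) (variance_poly * pderiv (voronovskaya_defect n p))
      + smult (1 / (2 * (real n)\<^sup>2))
          (variance_poly * pderiv (variance_poly * pderiv (pderiv p)))"
proof -
  have B: "bern_op n (poly ([:- y, 1:] * p)) = [:- y, 1:] * bern_op n (poly p)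
      + smult (1 / real n) (variance_poly * pderiv (bern_op n (poly p)))"
    unfolding bern_op_shift[OF assms, of y "poly p", symmetric]
    by (rule arg_cong[where f = "bern_op n"]) (simp add: fun_eq_iff algebra_simps)
  have p1: "pderiv [:- y, 1:] = 1"
    by (simp add: pderiv_pCons one_pCons)
  have P: "pderiv (pderiv ([:- y, 1:] * p)) = [:- y, 1:] * pderiv (pderiv p) + smult 2 (pderiv p)"
    by (intro poly_eq_poly_eq_iff[THEN iffD1] ext)
      (simp only: pderiv_mult p1 pderiv_add, simp add: algebra_simps)
  show ?thesis
    unfolding voronovskaya_defect_def B P using assms
    by (intro poly_eq_poly_eq_iff[THEN iffD1] ext)
      (simp add: pderiv_diff pderiv_add pderiv_smult pderiv_mult field_simps power2_eq_square)
qed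

section \<open>Uniformly bounded families of polynomials\<close>

text \<open>
  With the degrees bounded, a bound on the coefficients is a bound on all derivatives
  at once, and it is visibly stable under differentiation. The index set lets the same notion
  serve uniformity in the degree \<open>n\<close> alone and in \<open>n\<close> together with a base point \<open>y\<close>.
\<close>

definition bounded_family :: "'i set \<Rightarrow> ('i \<Rightarrow> real) \<Rightarrow> ('i \<Rightarrow> real poly) \<Rightarrow> bool" where
  "bounded_family I w P \<longleftrightarrow>
     (\<exists>d C. \<forall>i\<in>I. degree (P i) \<le> d \<and> (\<forall>j. \<bar>coeff (P i) j\<bar> \<le> C * w i))"

lemma bounded_familyI:
  assumes "\<And>i. i \<in> I \<Longrightarrow> degree (P i) \<le> d"
    and "\<And>i j. i \<in> I \<Longrightarrow> \<bar>coeff (P i) j\<bar> \<le> C * w i"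
  shows "bounded_family I w P"
  using assms unfolding bounded_family_def by blast

lemma bounded_family_cong:
  assumes "\<And>i. i \<in> I \<Longrightarrow> P i = Q i" and "bounded_family I w P"
  shows "bounded_family I w Q"
  using assms unfolding bounded_family_def by (metis (mono_tags, lifting))

lemma bounded_family_const: "bounded_family I (\<lambda>_. 1) (\<lambda>_. p)"
proof (rule bounded_familyI)
  fix i j
  show "\<bar>coeff p j\<bar> \<le> (\<Sum>j\<le>degree p. \<bar>coeff p j\<bar>) * 1"
    by (cases "j \<le> degree p") (auto intro!: member_le_sum simp: coeff_eq_0 sum_nonneg)
qed (rule order_refl)

lemma bounded_family_zero:  "bounded_family I w (\<lambda>_. 0)"
  by (rule bounded_familyI[where d=0 and C=0]) auto

lemma bounded_family_add:
  assumes "bounded_family I w P" and "bounded_family I w Q"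
  shows "bounded_family I w (\<lambda>i. P i + Q i)"
proof -
  obtain d C where P: "\<And>i. i \<in> I \<Longrightarrow> degree (P i) \<le> d"
      "\<And>i j. i \<in> I \<Longrightarrow> \<bar>coeff (P i) j\<bar> \<le> C * w i"
    using assms(1) unfolding bounded_family_def by metis
  obtain d' C' where Q: "\<And>i. i \<in> I \<Longrightarrow> degree (Q i) \<le> d'"
      "\<And>i j. i \<in> I \<Longrightarrow> \<bar>coeff (Q i) j\<bar> \<le> C' * w i"
    using assms(2) unfolding bounded_family_def by metis
  show ?thesis
  proof (rule bounded_familyI)
    fix i assume "i \<in> I"
    then show "degree (P i + Q i) \<le> max d d'"
      by (intro degree_add_le_max[THEN order_trans] max.mono P Q)
    fix j
    show "\<bar>coeff (P i + Q i) j\<bar> \<le> (C + C') * w i"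
      using P(2)[OF \<open>i \<in> I\<close>, of j] Q(2)[OF \<open>i \<in> I\<close>, of j] by (simp add: algebra_simps)
  qed
qed

lemma bounded_family_smult:
  assumes "bounded_family I w P"
    and "\<And>i. i \<in> I \<Longrightarrow> \<bar>c i\<bar> * w i \<le> D * w' i"
    and "D \<ge> 0" "\<And>i. i \<in> I \<Longrightarrow> w i \<ge> 0" "\<And>i. i \<in> I \<Longrightarrow> w' i \<ge> 0"
  shows "bounded_family I w' (\<lambda>i. smult (c i) (P i))"
proof -
  obtain d C where P: "\<And>i. i \<in> I \<Longrightarrow> degree (P i) \<le> d"
      "\<And>i j. i \<in> I \<Longrightarrow> \<bar>coeff (P i) j\<bar> \<le> C * w i"
    using assms(1) unfolding bounded_family_def by metis
  show ?thesis
  proof (rule bounded_familyI)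
    fix i assume i: "i \<in> I"
    then show "degree (smult (c i) (P i)) \<le> d"
      using P(1) degree_smult_le order_trans by blast
    fix j
    have "\<bar>coeff (smult (c i) (P i)) j\<bar> \<le> \<bar>c i\<bar> * (\<bar>C\<bar> * w i)"
      using P(2)[OF i, of j] assms(4)[OF i]
      by (auto simp: abs_mult intro!: mult_left_mono order_trans[OF P(2)[OF i]] mult_right_mono)
    also have "\<dots> \<le> \<bar>C\<bar> * (D * w' i)"
      using mult_left_mono[OF assms(2)[OF i], of "\<bar>C\<bar>"] by (simp add: algebra_simps)
    finally show "\<bar>coeff (smult (c i) (P i)) j\<bar> \<le> (\<bar>C\<bar> * D) * w' i"
      by (simp add: algebra_simps)
  qed
qed

lemma bounded_family_pCons_0:
  assumes "bounded_family I w P" and "\<And>i. i \<in> I \<Longrightarrow> w i \<ge> 0"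
  shows "bounded_family I w (\<lambda>i. pCons 0 (P i))"
proof -
  obtain d C where P: "\<And>i. i \<in> I \<Longrightarrow> degree (P i) \<le> d"
      "\<And>i j. i \<in> I \<Longrightarrow> \<bar>coeff (P i) j\<bar> \<le> C * w i"
    using assms(1) unfolding bounded_family_def by metis
  show ?thesis
  proof (rule bounded_familyI)
    fix i assume i: "i \<in> I"
    show "degree (pCons 0 (P i)) \<le> Suc d"
      using P(1)[OF i] degree_pCons_le[of 0 "P i"] by linarith
    fix j
    show "\<bar>coeff (pCons 0 (P i)) j\<bar> \<le> C * w i"
      using P(2)[OF i, of "j - 1"] by (cases j) auto
  qed
qed

lemma bounded_family_mult:
  assumes "bounded_family I w P" and "\<And>i. i \<in> I \<Longrightarrow> w i \<ge> 0"
  shows "bounded_family I w (\<lambda>i. p * P i)"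
proof (induction p)
  case 0
  then show ?case by (simp add: bounded_family_zero)
next
  case (pCons c p)
  have "bounded_family I w (\<lambda>i. smult c (P i) + pCons 0 (p * P i))"
    by (intro bounded_family_add bounded_family_pCons_0 pCons.IH
        bounded_family_smult[OF assms(1), where D = "\<bar>c\<bar>"]) (use assms in auto)
  then show ?case by simp
qed

lemma bounded_family_pderiv:
  assumes "bounded_family I w P" and "\<And>i. i \<in> I \<Longrightarrow> w i \<ge> 0"
  shows "bounded_family I w (\<lambda>i. pderiv (P i))"
proof -
  obtain d C where P: "\<And>i. i \<in> I \<Longrightarrow> degree (P i) \<le> d"
      "\<And>i j. i \<in> I \<Longrightarrow> \<bar>coeff (P i) j\<bar> \<le> C * w i"
    using assms(1) unfolding bounded_family_def by metis
  show ?thesis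
  proof (rule bounded_familyI)
    fix i assume i: "i \<in> I"
    show "degree (pderiv (P i)) \<le> d"
      using P(1)[OF i] by (simp add: degree_pderiv)
    fix j
    have Cw: "0 \<le> C * w i"
      using P(2)[OF i, of 0] by linarith
    show "\<bar>coeff (pderiv (P i)) j\<bar> \<le> (real d * C) * w i"
    proof (cases "Suc j \<le> d")
      case True
      have "\<bar>coeff (pderiv (P i)) j\<bar> = real (Suc j) * \<bar>coeff (P i) (Suc j)\<bar>"
        by (simp add: coeff_pderiv abs_mult)
      also have "\<dots> \<le> real d * (C * w i)"
        using True P(2)[OF i] by (intro mult_mono) auto
      finally show ?thesis by (simp add: algebra_simps)
    next
      case False
      then have "coeff (P i) (Suc j) = 0"
        using P(1)[OF i] by (intro coeff_eq_0) linarith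
      then show ?thesis
        using mult_nonneg_nonneg[OF _ Cw, of "real d"] by (simp add: coeff_pderiv algebra_simps)
    qed
  qed
qed

lemma bounded_family_higher_pderiv:
  assumes "bounded_family I w P" and "\<And>i. i \<in> I \<Longrightarrow> w i \<ge> 0"
  shows "bounded_family I w (\<lambda>i. (pderiv ^^ l) (P i))"
  by (induction l) (simp_all add: assms bounded_family_pderiv)

lemma bounded_family_sum:
  assumes "finite A" and "\<And>m. m \<in> A \<Longrightarrow> bounded_family I w (P m)"
  shows "bounded_family I w (\<lambda>i. \<Sum>m\<in>A. P m i)"
  using assms by (induction A rule: finite_induct)
    (simp_all add: bounded_family_zero bounded_family_add)

lemma bounded_family_poly:
  assumes "bounded_family I w P"
  obtains C where "\<And>i x. i \<in> I \<Longrightarrow> \<bar>x\<bar> \<le> 1 \<Longrightarrow> \<bar>poly (P i) x\<bar> \<le> C * w i"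
proof -
  obtain d C where P: "\<And>i. i \<in> I \<Longrightarrow> degree (P i) \<le> d"
      "\<And>i j. i \<in> I \<Longrightarrow> \<bar>coeff (P i) j\<bar> \<le> C * w i"
    using assms unfolding bounded_family_def by metis
  have "\<bar>poly (P i) x\<bar> \<le> (real (Suc d) * C) * w i" if i: "i \<in> I" and x: "\<bar>x\<bar> \<le> 1" for i x
  proof -
    have Cw: "0 \<le> C * w i"
      using P(2)[OF i, of 0] by linarith
    have "\<bar>poly (P i) x\<bar> \<le> (\<Sum>j\<le>degree (P i). \<bar>coeff (P i) j * x ^ j\<bar>)"
      by (simp only: poly_altdef) (rule sum_abs)
    also have "\<dots> \<le> (\<Sum>j\<le>degree (P i). C * w i)"
    proof (rule sum_mono)
      fix j
      have "\<bar>coeff (P i) j\<bar> * \<bar>x\<bar> ^ j \<le> (C * w i) * 1"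
        using P(2)[OF i] x Cw by (intro mult_mono power_le_one) auto
      then show "\<bar>coeff (P i) j * x ^ j\<bar> \<le> C * w i"
        by (simp add: abs_mult power_abs)
    qed
    also have "\<dots> = real (Suc (degree (P i))) * (C * w i)"
      by simp
    also have "\<dots> \<le> real (Suc d) * (C * w i)"
      using P(1)[OF i] Cw by (intro mult_right_mono) auto
    finally show ?thesis by (simp add: algebra_simps)
  qed
  then show ?thesis by (rule that)
qed

section \<open>The quadratic decay of the defect\<close>

lemma bounded_family_power:
  assumes "\<And>i. i \<in> I \<Longrightarrow> \<bar>y i\<bar> \<le> 1"
  shows "bounded_family I (\<lambda>_. 1) (\<lambda>i. [:- y i, 1:] ^ m)"
proof (induction m)
  case 0
  show ?case by (simp add: bounded_family_const)
next
  case (Suc m)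
  have "bounded_family I (\<lambda>_. 1)
      (\<lambda>i. smult (- y i) ([:- y i, 1:] ^ m) + pCons 0 ([:- y i, 1:] ^ m))"
    by (intro bounded_family_add bounded_family_pCons_0 Suc.IH
        bounded_family_smult[OF Suc.IH, where D = 1]) (use assms in auto)
  then show ?case by simp
qed

text \<open>
  Induction along the shift rule: each of its three terms keeps the factor \<open>1/n\<^sup>2\<close>. Powers of
  \<open>x - y\<close> rather than monomials appear because Taylor polynomials are centred at \<open>y\<close>.
\<close>

lemma bounded_family_defect_power:
  "bounded_family {(n, y). 1 \<le> n \<and> \<bar>y\<bar> \<le> 1} (\<lambda>(n, y). 1 / (real n)\<^sup>2)
     (\<lambda>(n, y). voronovskaya_defect n ([:- y, 1:] ^ m))" (is "bounded_family ?I ?w (?V m)")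
proof (induction m)
  case 0
  show ?case by (simp add: voronovskaya_defect_1 bounded_family_zero case_prod_unfold)
next
  case (Suc m)
  let ?p = "\<lambda>i::nat \<times> real. [:- snd i, 1:] ^ m"
  have w: "\<And>i. i \<in> ?I \<Longrightarrow> ?w i \<ge> 0"
    by auto
  have le: "1 / real n * (1 / (real n)\<^sup>2) \<le> 1 / (real n)\<^sup>2" if "1 \<le> n" for n :: nat
    using that by (simp add: field_simps)
  have V: "bounded_family ?I ?w (\<lambda>i. voronovskaya_defect (fst i) (?p i))"
    using Suc by (simp add: case_prod_unfold)
  have P: "bounded_family ?I (\<lambda>_. 1)
      (\<lambda>i. variance_poly * pderiv (variance_poly * pderiv (pderiv (?p i))))"
    by (intro bounded_family_mult bounded_family_pderiv bounded_family_power) auto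
  have "bounded_family ?I ?w (\<lambda>i. (smult (- snd i) (voronovskaya_defect (fst i) (?p i))
          + pCons 0 (voronovskaya_defect (fst i) (?p i)))
        + smult (1 / real (fst i)) (variance_poly * pderiv (voronovskaya_defect (fst i) (?p i)))
        + smult (1 / (2 * (real (fst i))\<^sup>2))
            (variance_poly * pderiv (variance_poly * pderiv (pderiv (?p i)))))"
  proof (intro bounded_family_add bounded_family_pCons_0 V)
    show "bounded_family ?I ?w (\<lambda>i. smult (- snd i) (voronovskaya_defect (fst i) (?p i)))"
      by (rule bounded_family_smult[OF V, where D = 1]) (auto simp: divide_right_mono)
    show "bounded_family ?I ?w (\<lambda>i. smult (1 / real (fst i))
        (variance_poly * pderiv (voronovskaya_defect (fst i) (?p i))))"
      by (rule bounded_family_smult[OF bounded_family_mult[OF bounded_family_pderiv[OF V w] w],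
            where D = 1]) (use le in \<open>auto simp: mult.commute\<close>)
    show "bounded_family ?I ?w (\<lambda>i. smult (1 / (2 * (real (fst i))\<^sup>2))
            (variance_poly * pderiv (variance_poly * pderiv (pderiv (?p i)))))"
      by (rule bounded_family_smult[OF P, where D = 1]) (auto simp: divide_simps)
  qed (use w in auto)
  then show ?case
    by (rule bounded_family_cong[rotated])
      (auto simp: power_Suc voronovskaya_defect_shift simp del: mult_pCons_left, simp)
qed

text \<open>
  The defect is linear, so the estimate for powers extends to all polynomials whose
  coefficients at a varying centre are bounded, as those of Taylor polynomials are.
\<close>

lemma voronovskaya_bounded_coefficients:
  fixes c :: "nat \<Rightarrow> real \<Rightarrow> real"
  assumes "\<And>m y. m < d \<Longrightarrow> y \<in> K \<Longrightarrow> \<bar>c m y\<bar> \<le> A m" and "K \<subseteq> {0..1}"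
  obtains C where "\<And>n y x. 1 \<le> n \<Longrightarrow> y \<in> K \<Longrightarrow> \<bar>x\<bar> \<le> 1 \<Longrightarrow>
    \<bar>poly ((pderiv ^^ l) (voronovskaya_defect n (\<Sum>m<d. smult (c m y) ([:- y, 1:] ^ m)))) x\<bar>
      \<le> C / (real n)\<^sup>2"
proof -
  define I where "I = {(n::nat, y). 1 \<le> n \<and> y \<in> K}"
  have sub: "I \<subseteq> {(n, y). 1 \<le> n \<and> \<bar>y\<bar> \<le> 1}"
    using assms(2) by (auto simp: I_def)
  have V: "bounded_family I (\<lambda>i. 1 / (real (fst i))\<^sup>2)
      (\<lambda>i. voronovskaya_defect (fst i) ([:- snd i, 1:] ^ m))" for m
    using bounded_family_defect_power[of m] sub
    unfolding bounded_family_def case_prod_unfold by (meson subsetD)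
  have "bounded_family I (\<lambda>i. 1 / (real (fst i))\<^sup>2)
      (\<lambda>i. (pderiv ^^ l) (\<Sum>m\<in>{..<d}. smult (c m (snd i))
        (voronovskaya_defect (fst i) ([:- snd i, 1:] ^ m))))"
  proof (intro bounded_family_higher_pderiv bounded_family_sum)
    fix m assume "m \<in> {..<d}"
    then have m: "m < d" by simp
    show "bounded_family I (\<lambda>i. 1 / (real (fst i))\<^sup>2)
      (\<lambda>i. smult (c m (snd i)) (voronovskaya_defect (fst i) ([:- snd i, 1:] ^ m)))"
    proof (rule bounded_family_smult[OF V, where D = "\<bar>A m\<bar>"])
      fix i assume "i \<in> I"
      then have "\<bar>c m (snd i)\<bar> \<le> \<bar>A m\<bar>"
        using assms(1)[OF m, of "snd i"] by (auto simp: I_def)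
      then show "\<bar>c m (snd i)\<bar> * (1 / (real (fst i))\<^sup>2) \<le> \<bar>A m\<bar> * (1 / (real (fst i))\<^sup>2)"
        by (intro mult_right_mono) auto
    qed auto
  qed auto
  then obtain C where "\<And>i x. i \<in> I \<Longrightarrow> \<bar>x\<bar> \<le> 1 \<Longrightarrow>
      \<bar>poly ((pderiv ^^ l) (\<Sum>m\<in>{..<d}. smult (c m (snd i))
        (voronovskaya_defect (fst i) ([:- snd i, 1:] ^ m)))) x\<bar> \<le> C * (1 / (real (fst i))\<^sup>2)"
    by (rule bounded_family_poly) blast
  from this[of "(n, y)" for n y] show ?thesis
    by (intro that[of C]) (auto simp: I_def voronovskaya_defect_sum)
qed

section \<open>Central moments of the binomial distribution\<close>

text \<open>
  With \<open>S\<close> binomially distributed with parameters \<open>n\<close> and \<open>x\<close>, this is the expectation of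
  \<open>(S - n x)^r\<close>, as a polynomial in \<open>x\<close>.
\<close>

definition central_moment :: "nat \<Rightarrow> nat \<Rightarrow> real poly" where
  "central_moment r n = (\<Sum>k\<le>n. [:real k, - real n:] ^ r * basis_poly n k)"

lemma central_moment_0: "central_moment 0 n = 1"
  by (simp add: central_moment_def sum_basis_poly)

text \<open>
  Differentiate the moment and multiply by \<open>x(1 - x)\<close>: the derivative of the basis polynomial
  raises the power of \<open>k - n x\<close>, and the derivative of \<open>(k - n x)^r\<close> in \<open>x\<close> lowers it at the
  cost of a factor \<open>n\<close>. For \<open>r = 0\<close> the natural number \<open>r - 1\<close> is a harmless default, as its
  coefficient vanishes.
\<close>

lemma central_moment_recursion:
  "central_moment (Suc r) n = variance_poly * pderiv (central_moment r n)
     + smult (real r * real n) (variance_poly * central_moment (r - 1) n)"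
proof -
  have step: "[:real k, - real n:] ^ Suc r * basis_poly n k
      = variance_poly * pderiv ([:real k, - real n:] ^ r * basis_poly n k)
        + smult (real r * real n) (variance_poly * ([:real k, - real n:] ^ (r - 1) * basis_poly n k))"
    if "k \<le> n" for k
  proof -
    let ?a = "[:real k, - real n:]"
    have a: "pderiv ?a = [:- real n:]"
      by (simp add: pderiv_pCons)
    have "variance_poly * pderiv (?a ^ r * basis_poly n k)
        = ?a ^ r * (variance_poly * pderiv (basis_poly n k))
          + variance_poly * basis_poly n k * pderiv (?a ^ r)"
      by (simp only: pderiv_mult) (simp only: algebra_simps)
    also have "pderiv (?a ^ r) = smult (- real r * real n) (?a ^ (r - 1))"
      by (simp only: pderiv_power a) (simp add: mult.commute)
    finally show ?thesis
      unfolding variance_times_pderiv_basis[OF that]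
      by (intro poly_eq_poly_eq_iff[THEN iffD1] ext) (simp add: algebra_simps)
  qed
  have "central_moment (Suc r) n
      = (\<Sum>k\<le>n. variance_poly * pderiv ([:real k, - real n:] ^ r * basis_poly n k)
        + smult (real r * real n) (variance_poly * ([:real k, - real n:] ^ (r - 1) * basis_poly n k)))"
    unfolding central_moment_def by (intro sum.cong refl step) simp
  then show ?thesis
    unfolding central_moment_def pderiv_sum_poly
    by (simp only: sum.distrib sum_distrib_left smult_sum_right)
qed

text \<open>
  The recursion gains a factor \<open>n\<close> only when it goes back two orders, whence the exponent
  \<open>r div 2\<close>.
\<close>

lemma bounded_family_central_moment:
  "bounded_family {n::nat. 1 \<le> n} (\<lambda>n. real n ^ (r div 2)) (central_moment r)"
proof (induction r rule: less_induct)
  case (less r)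
  let ?I = "{n::nat. 1 \<le> n}"
  show ?case
  proof (cases r)
    case 0
    then show ?thesis
      using bounded_family_const[of ?I 1] by (simp add: central_moment_0[abs_def])
  next
    case (Suc s)
    have 1: "bounded_family ?I (\<lambda>n. real n ^ (r div 2))
        (\<lambda>n. smult 1 (variance_poly * pderiv (central_moment s n)))"
      by (rule bounded_family_smult[OF bounded_family_mult[OF bounded_family_pderiv[OF less.IH]],
            of s, where D = 1]) (auto simp: Suc intro!: power_increasing div_le_mono)
    have 2: "bounded_family ?I (\<lambda>n. real n ^ (r div 2))
        (\<lambda>n. smult (real s * real n) (variance_poly * central_moment (s - 1) n))"
    proof (cases s)
      case 0
      then show ?thesis by (simp add: bounded_family_zero)
    next
      case (Suc t)
      then have r: "r div 2 = Suc ((s - 1) div 2)"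
        using \<open>r = Suc s\<close> by simp
      show ?thesis
        by (rule bounded_family_smult[OF bounded_family_mult[OF less.IH], of "s - 1",
            where D = "real s"]) (auto simp: \<open>r = Suc s\<close> r[unfolded \<open>r = Suc s\<close>])
    qed
    show ?thesis
      by (rule bounded_family_cong[OF _ bounded_family_add[OF 1 2]])
        (simp add: Suc central_moment_recursion)
  qed
qed

lemma even_moment_bound:
  obtains C where "\<And>n x. 1 \<le> n \<Longrightarrow> 0 \<le> x \<Longrightarrow> x \<le> 1 \<Longrightarrow>
    (\<Sum>k\<le>n. (real k - real n * x) ^ (2 * s) * Bernstein n k x) \<le> C * real n ^ s"
proof -
  obtain C where C: "\<And>n x. n \<in> {n::nat. 1 \<le> n} \<Longrightarrow> \<bar>x\<bar> \<le> 1 \<Longrightarrow>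
      \<bar>poly (central_moment (2 * s) n) x\<bar> \<le> C * real n ^ (2 * s div 2)"
    using bounded_family_poly[OF bounded_family_central_moment[of "2 * s"]] by metis
  have "poly (central_moment (2 * s) n) x
      = (\<Sum>k\<le>n. (real k - real n * x) ^ (2 * s) * Bernstein n k x)" for n x
    by (simp add: central_moment_def poly_sum poly_basis_poly mult.commute)
  then show ?thesis
    using C by (intro that[of C]) (force dest: abs_le_D1)
qed

section \<open>Derivatives of the basis polynomials\<close>

text \<open>
  Symbols of order \<open>s\<close> are polynomial expressions in \<open>n\<close>, \<open>k - n x\<close> and \<open>x\<close> in which \<open>n\<close> has
  weight 2 and \<open>k - n x\<close> has weight 1. This is their natural scaling, since the standard
  deviation of the binomial distribution is of order \<open>sqrt n\<close>. The grading is
  what makes the size of the derivatives of the basis polynomials easy to follow.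
\<close>

inductive symbol :: "nat \<Rightarrow> (nat \<Rightarrow> nat \<Rightarrow> real poly) \<Rightarrow> bool" where
  symbol_1: "symbol 0 (\<lambda>n k. 1)"
| symbol_add: "symbol s P \<Longrightarrow> symbol s Q \<Longrightarrow> symbol s (\<lambda>n k. P n k + Q n k)"
| symbol_Suc: "symbol s P \<Longrightarrow> symbol (Suc s) P"
| symbol_mult: "symbol s P \<Longrightarrow> symbol s (\<lambda>n k. p * P n k)"
| symbol_degree: "symbol s P \<Longrightarrow> symbol (Suc (Suc s)) (\<lambda>n k. smult (real n) (P n k))"
| symbol_deviation: "symbol s P \<Longrightarrow> symbol (Suc s) (\<lambda>n k. [:real k, - real n:] * P n k)"

text \<open>
  The only step that raises the order is the derivative \<open>- n\<close> of the deviation \<open>k - n x\<close>: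
  a factor of weight 1 is replaced by one of weight 2.
\<close>

lemma symbol_pderiv: "symbol s P \<Longrightarrow> symbol (Suc s) (\<lambda>n k. pderiv (P n k))"
proof (induction rule: symbol.induct)
  case symbol_1
  show ?case using symbol_Suc[OF symbol.symbol_mult[OF symbol.symbol_1, of 0]] by simp
next
  case (symbol_add s P Q)
  then show ?case by (simp add: pderiv_add symbol.symbol_add)
next
  case (symbol_Suc s P)
  then show ?case by (blast intro: symbol.symbol_Suc)
next
  case (symbol_mult s P p)
  show ?case
    unfolding pderiv_mult
    using symbol.symbol_add[OF symbol.symbol_mult[OF symbol_mult.IH, of p]
        symbol.symbol_mult[OF symbol.symbol_Suc[OF symbol_mult.hyps], of "pderiv p"]]
    by (simp add: mult.commute)
next
  case (symbol_degree s P)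
  then show ?case by (simp add: pderiv_smult symbol.symbol_degree)
next
  case (symbol_deviation s P)
  have "symbol (Suc (Suc s)) (\<lambda>n k. [:-1:] * smult (real n) (P n k)
      + [:real k, - real n:] * pderiv (P n k))"
    by (intro symbol.symbol_add symbol.symbol_mult symbol.symbol_degree symbol.symbol_deviation
        symbol_deviation)
  moreover have "(\<lambda>n k. pderiv ([:real k, - real n:] * P n k))
      = (\<lambda>n k. [:-1:] * smult (real n) (P n k) + [:real k, - real n:] * pderiv (P n k))"
    by (simp add: fun_eq_iff pderiv_mult[of "[:_, _:]"] pderiv_pCons del: mult_pCons_left) (simp add: algebra_simps)
  ultimately show ?case by simp
qed

text \<open>
  By \<open>n = (sqrt n)\<^sup>2\<close>, both \<open>n\<close> and the deviation are bounded by powers of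
  \<open>sqrt n + \<bar>k - n x\<bar>\<close> according to their weights. This quantity is at least 1, so symbols of
  lower order satisfy the bound of the higher one.
\<close>

lemma symbol_bound:
  "symbol s P \<Longrightarrow> \<exists>C\<ge>0. \<forall>n k x. 1 \<le> n \<longrightarrow> 0 \<le> x \<longrightarrow> x \<le> 1 \<longrightarrow>
     \<bar>poly (P n k) x\<bar> \<le> C * (sqrt (real n) + \<bar>real k - real n * x\<bar>) ^ s"
proof (induction rule: symbol.induct)
  case symbol_1
  show ?case by (rule exI[of _ 1]) simp
next
  case (symbol_add s P Q)
  then obtain C D where C: "C \<ge> 0" "\<And>n k x. 1 \<le> n \<Longrightarrow> 0 \<le> x \<Longrightarrow> x \<le> 1 \<Longrightarrow>
      \<bar>poly (P n k) x\<bar> \<le> C * (sqrt (real n) + \<bar>real k - real n * x\<bar>) ^ s"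
    and D: "D \<ge> 0" "\<And>n k x. 1 \<le> n \<Longrightarrow> 0 \<le> x \<Longrightarrow> x \<le> 1 \<Longrightarrow>
      \<bar>poly (Q n k) x\<bar> \<le> D * (sqrt (real n) + \<bar>real k - real n * x\<bar>) ^ s"
    by metis
  show ?case
  proof (intro exI[of _ "C + D"] conjI allI impI)
    fix n k :: nat and x :: real assume "1 \<le> n" "0 \<le> x" "x \<le> 1"
    from C(2)[OF this, of k] D(2)[OF this, of k]
    show "\<bar>poly (P n k + Q n k) x\<bar> \<le> (C + D) * (sqrt (real n) + \<bar>real k - real n * x\<bar>) ^ s"
      by (simp add: distrib_right)
  qed (use C D in simp)
next
  case (symbol_Suc s P)
  then obtain C where C: "C \<ge> 0" "\<And>n k x. 1 \<le> n \<Longrightarrow> 0 \<le> x \<Longrightarrow> x \<le> 1 \<Longrightarrow>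
      \<bar>poly (P n k) x\<bar> \<le> C * (sqrt (real n) + \<bar>real k - real n * x\<bar>) ^ s"
    by metis
  show ?case
  proof (intro exI[of _ C] conjI allI impI C(1))
    fix n k :: nat and x :: real assume *: "1 \<le> n" "0 \<le> x" "x \<le> 1"
    let ?u = "sqrt (real n) + \<bar>real k - real n * x\<bar>"
    have "1 \<le> sqrt (real n)" using * by simp
    then have "1 \<le> ?u" by linarith
    then have "?u ^ s \<le> ?u ^ Suc s" by (intro power_increasing) auto
    then show "\<bar>poly (P n k) x\<bar> \<le> C * ?u ^ Suc s"
      using C(2)[OF *, of k] mult_left_mono[OF _ C(1)] order_trans by blast
  qed
next
  case (symbol_mult s P p)
  then obtain C where C: "C \<ge> 0" "\<And>n k x. 1 \<le> n \<Longrightarrow> 0 \<le> x \<Longrightarrow> x \<le> 1 \<Longrightarrow>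
      \<bar>poly (P n k) x\<bar> \<le> C * (sqrt (real n) + \<bar>real k - real n * x\<bar>) ^ s"
    by metis
  obtain A where A: "\<And>x. \<bar>x\<bar> \<le> 1 \<Longrightarrow> \<bar>poly p x\<bar> \<le> A"
    using bounded_family_poly[OF bounded_family_const[of UNIV p]] by (metis UNIV_I mult_1_right)
  have "0 \<le> A" using A[of 0] by simp
  show ?case
  proof (intro exI[of _ "A * C"] conjI allI impI)
    fix n k :: nat and x :: real assume *: "1 \<le> n" "0 \<le> x" "x \<le> 1"
    show "\<bar>poly (p * P n k) x\<bar> \<le> A * C * (sqrt (real n) + \<bar>real k - real n * x\<bar>) ^ s"
      using mult_mono[OF A[of x] C(2)[OF *, of k]] * \<open>0 \<le> A\<close> by (simp add: abs_mult mult.assoc)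
  qed (use C \<open>0 \<le> A\<close> in simp)
next
  case (symbol_degree s P)
  then obtain C where C: "C \<ge> 0" "\<And>n k x. 1 \<le> n \<Longrightarrow> 0 \<le> x \<Longrightarrow> x \<le> 1 \<Longrightarrow>
      \<bar>poly (P n k) x\<bar> \<le> C * (sqrt (real n) + \<bar>real k - real n * x\<bar>) ^ s"
    by metis
  show ?case
  proof (intro exI[of _ C] conjI allI impI C(1))
    fix n k :: nat and x :: real assume *: "1 \<le> n" "0 \<le> x" "x \<le> 1"
    let ?u = "sqrt (real n) + \<bar>real k - real n * x\<bar>"
    have "(sqrt (real n))\<^sup>2 \<le> ?u\<^sup>2"
      by (intro power_mono) auto
    then have "real n * \<bar>poly (P n k) x\<bar> \<le> ?u\<^sup>2 * (C * ?u ^ s)"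
      using C(2)[OF *, of k] by (intro mult_mono) auto
    then show "\<bar>poly (smult (real n) (P n k)) x\<bar> \<le> C * ?u ^ Suc (Suc s)"
      by (simp add: abs_mult power2_eq_square mult_ac)
  qed
next
  case (symbol_deviation s P)
  then obtain C where C: "C \<ge> 0" "\<And>n k x. 1 \<le> n \<Longrightarrow> 0 \<le> x \<Longrightarrow> x \<le> 1 \<Longrightarrow>
      \<bar>poly (P n k) x\<bar> \<le> C * (sqrt (real n) + \<bar>real k - real n * x\<bar>) ^ s"
    by metis
  show ?case
  proof (intro exI[of _ C] conjI allI impI C(1))
    fix n k :: nat and x :: real assume *: "1 \<le> n" "0 \<le> x" "x \<le> 1"
    let ?u = "sqrt (real n) + \<bar>real k - real n * x\<bar>"
    have "\<bar>real k - real n * x\<bar> * \<bar>poly (P n k) x\<bar> \<le> ?u * (C * ?u ^ s)"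
      using C(2)[OF *, of k] by (intro mult_mono) auto
    moreover have "poly ([:real k, - real n:] * P n k) x = (real k - real n * x) * poly (P n k) x"
      by (simp add: algebra_simps)
    ultimately show "\<bar>poly ([:real k, - real n:] * P n k) x\<bar> \<le> C * ?u ^ Suc s"
      by (simp add: abs_mult mult_ac)
  qed
qed

text \<open>
  Each differentiation costs a factor \<open>x(1 - x)\<close> and raises the order by one, either by acting
  on the symbol already present or by the deviation that comes from the differential equation
  of the basis.
\<close>

lemma higher_pderiv_basis_symbol:
  "\<exists>P. symbol l P \<and> (\<forall>n k. k \<le> n \<longrightarrow>
     variance_poly ^ l * (pderiv ^^ l) (basis_poly n k) = P n k * basis_poly n k)"
proof (induction l)
  case 0
  show ?case by (rule exI[of _ "\<lambda>n k. 1"]) (simp add: symbol_1)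
next
  case (Suc l)
  let ?q = variance_poly
  obtain P where P: "symbol l P" and eq: "\<And>n k. k \<le> n \<Longrightarrow>
      ?q ^ l * (pderiv ^^ l) (basis_poly n k) = P n k * basis_poly n k"
    using Suc.IH by blast
  \<comment> \<open>The last summand compensates for the derivative of the factor \<open>variance_poly ^ l\<close>.\<close>
  define Q where "Q n k = (?q * pderiv (P n k) + [:real k, - real n:] * P n k)
      + smult (- real l) (pderiv ?q) * P n k" for n k
  have "symbol (Suc l) Q"
    unfolding Q_def[abs_def]
    by (intro symbol_add symbol_mult symbol_pderiv symbol_deviation symbol_Suc P)
  moreover have "?q ^ Suc l * (pderiv ^^ Suc l) (basis_poly n k) = Q n k * basis_poly n k"
    if k: "k \<le> n" for n k
  proof -
    let ?b = "basis_poly n k" and ?bl = "(pderiv ^^ l) (basis_poly n k)"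
    have q: "?q * pderiv (?q ^ l) = smult (real l) (pderiv ?q) * ?q ^ l"
    proof (cases l)
      case (Suc m)
      show ?thesis
        unfolding Suc by (simp only: pderiv_power_Suc) (simp add: algebra_simps)
    qed simp
    have "?q * pderiv (?q ^ l * ?bl) = ?q * pderiv (P n k * ?b)"
      by (simp only: eq[OF k])
    then have "?q ^ Suc l * pderiv ?bl + ?bl * (?q * pderiv (?q ^ l))
        = P n k * (?q * pderiv ?b) + ?q * pderiv (P n k) * ?b"
      by (simp only: pderiv_mult) (simp add: algebra_simps)
    then have "?q ^ Suc l * pderiv ?bl + smult (real l) (pderiv ?q) * (?q ^ l * ?bl)
        = P n k * ([:real k, - real n:] * ?b) + ?q * pderiv (P n k) * ?b"
      unfolding q variance_times_pderiv_basis[OF k] by (simp only: mult_ac)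
    then have "?q ^ Suc l * pderiv ?bl = P n k * ([:real k, - real n:] * ?b)
        + ?q * pderiv (P n k) * ?b - smult (real l) (pderiv ?q) * (P n k * ?b)"
      unfolding eq[OF k] by (simp only: eq_diff_eq)
    then show ?thesis
      by (simp only: Q_def funpow.simps comp_def) (simp add: algebra_simps del: mult_pCons_left mult_pCons_right)
  qed
  ultimately show ?case by blast
qed

text \<open>
  Differentiating \<open>l\<close> times costs at most \<open>(sqrt n + \<bar>k - n x\<bar>)^l\<close>. A function that vanishes to
  order \<open>l + 4\<close> at \<open>x\<close> contributes \<open>\<bar>k - n x\<bar>^(l + 4) / n^(l + 4)\<close>. Together this is at most
  \<open>(sqrt n + \<bar>k - n x\<bar>)^(2 (l + 2))\<close> divided by \<open>n^(l + 4)\<close>. The exponent is even, so the mean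
  of the numerator is controlled by a central moment and is of size \<open>n^(l + 2)\<close>; what
  remains is exactly \<open>1/n\<^sup>2\<close>.

  The constant does not depend on \<open>R\<close>, so that the bound can be used
  with a different Taylor remainder at each point \<open>x\<close>.
\<close>

lemma remainder_estimate:
  assumes "c > 0"
  obtains C where "C \<ge> 0" and "\<And>n R x M. 1 \<le> n \<Longrightarrow> 0 \<le> x \<Longrightarrow> x \<le> 1 \<Longrightarrow>
    c \<le> x * (1 - x) \<Longrightarrow> 0 \<le> M \<Longrightarrow>
    (\<And>t. 0 \<le> t \<Longrightarrow> t \<le> 1 \<Longrightarrow> \<bar>R t\<bar> \<le> M * \<bar>t - x\<bar> ^ (l + 4)) \<Longrightarrow>
    \<bar>poly ((pderiv ^^ l) (bern_op n R)) x\<bar> \<le> C * M / (real n)\<^sup>2"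
proof -
  obtain P where P: "symbol l P" and eq: "\<And>n k. k \<le> n \<Longrightarrow>
      variance_poly ^ l * (pderiv ^^ l) (basis_poly n k) = P n k * basis_poly n k"
    using higher_pderiv_basis_symbol by blast
  obtain A where A: "A \<ge> 0" "\<And>n k x. 1 \<le> n \<Longrightarrow> 0 \<le> x \<Longrightarrow> x \<le> 1 \<Longrightarrow>
      \<bar>poly (P n k) x\<bar> \<le> A * (sqrt (real n) + \<bar>real k - real n * x\<bar>) ^ l"
    using symbol_bound[OF P] by metis
  obtain D where D: "\<And>n x. 1 \<le> n \<Longrightarrow> 0 \<le> x \<Longrightarrow> x \<le> 1 \<Longrightarrow>
    (\<Sum>k\<le>n. (real k - real n * x) ^ (2 * (l + 2)) * Bernstein n k x) \<le> D * real n ^ (l + 2)"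
    by (rule even_moment_bound) blast
  define E where "E = 2 ^ (2 * (l + 2)) * (1 + \<bar>D\<bar>)"
  have moment: "(\<Sum>k\<le>n. (sqrt (real n) + \<bar>real k - real n * x\<bar>) ^ (2 * (l + 2)) * Bernstein n k x)
      \<le> E * real n ^ (l + 2)" if *: "1 \<le> n" "0 \<le> x" "x \<le> 1" for n x
  proof -
    have pow: "(u + v) ^ p \<le> 2 ^ p * (u ^ p + v ^ p)" if "0 \<le> u" "0 \<le> v" for u v :: real and p
    proof -
      have "(u + v) ^ p \<le> (2 * max u v) ^ p"
        using that by (intro power_mono) auto
      also have "\<dots> = 2 ^ p * max u v ^ p"
        by (simp add: power_mult_distrib)
      also have "max u v ^ p \<le> u ^ p + v ^ p"
        using that by (simp add: max_def)
      finally show ?thesis by simp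
    qed
    have summand: "(sqrt (real n) + \<bar>real k - real n * x\<bar>) ^ (2 * (l + 2))
        \<le> 2 ^ (2 * (l + 2)) * (real n ^ (l + 2) + (real k - real n * x) ^ (2 * (l + 2)))" for k
      using pow[of "sqrt (real n)" "\<bar>real k - real n * x\<bar>" "2 * (l + 2)"]
      by (simp add: power_mult power_even_abs del: mult_Suc_right)
    have "(\<Sum>k\<le>n. (sqrt (real n) + \<bar>real k - real n * x\<bar>) ^ (2 * (l + 2)) * Bernstein n k x)
        \<le> (\<Sum>k\<le>n. (2 ^ (2 * (l + 2)) * (real n ^ (l + 2) + (real k - real n * x) ^ (2 * (l + 2))))
            * Bernstein n k x)"
      by (intro sum_mono mult_right_mono summand Bernstein_nonneg *)
    also have "\<dots> = 2 ^ (2 * (l + 2)) * (real n ^ (l + 2) * (\<Sum>k\<le>n. Bernstein n k x)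
        + (\<Sum>k\<le>n. (real k - real n * x) ^ (2 * (l + 2)) * Bernstein n k x))"
      by (simp only: sum_distrib_left sum.distrib[symmetric] distrib_left distrib_right mult.assoc)
    also have "\<dots> \<le> 2 ^ (2 * (l + 2)) * (real n ^ (l + 2) + \<bar>D\<bar> * real n ^ (l + 2))"
    proof -
      have "D * real n ^ (l + 2) \<le> \<bar>D\<bar> * real n ^ (l + 2)"
        by (intro mult_right_mono) auto
      then show ?thesis
        using D[OF *] by (intro mult_left_mono) auto
    qed
    finally show ?thesis by (simp add: E_def algebra_simps)
  qed
  have E: "E \<ge> 0" by (simp add: E_def)
  show ?thesis
  proof (rule that[of "A * E / c ^ l"])
    show "0 \<le> A * E / c ^ l" using A(1) E assms by simp
    fix n :: nat and R :: "real \<Rightarrow> real" and x M :: real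
    assume n: "1 \<le> n" and x: "0 \<le> x" "x \<le> 1" and c: "c \<le> x * (1 - x)" and M: "0 \<le> M"
      and R: "\<And>t. 0 \<le> t \<Longrightarrow> t \<le> 1 \<Longrightarrow> \<bar>R t\<bar> \<le> M * \<bar>t - x\<bar> ^ (l + 4)"
    let ?u = "\<lambda>k. sqrt (real n) + \<bar>real k - real n * x\<bar>"
    have "variance_poly ^ l * (pderiv ^^ l) (bern_op n R)
        = (\<Sum>k\<le>n. smult (R (real k / real n)) (P n k * basis_poly n k))"
      unfolding bern_op_def higher_pderiv_sum higher_pderiv_smult sum_distrib_left
      by (intro sum.cong refl) (simp add: eq)
    then have "poly (variance_poly ^ l * (pderiv ^^ l) (bern_op n R)) x
        = poly (\<Sum>k\<le>n. smult (R (real k / real n)) (P n k * basis_poly n k)) x"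
      by simp
    then have "(x * (1 - x)) ^ l * poly ((pderiv ^^ l) (bern_op n R)) x
        = (\<Sum>k\<le>n. R (real k / real n) * (poly (P n k) x * Bernstein n k x))"
      by (simp only: poly_mult poly_power poly_variance_poly poly_sum poly_smult poly_basis_poly)
    then have "(x * (1 - x)) ^ l * \<bar>poly ((pderiv ^^ l) (bern_op n R)) x\<bar>
        = \<bar>\<Sum>k\<le>n. R (real k / real n) * (poly (P n k) x * Bernstein n k x)\<bar>"
      using x by (metis abs_mult abs_of_nonneg diff_ge_0_iff_ge mult_nonneg_nonneg zero_le_power)
    also have "\<dots> \<le> (\<Sum>k\<le>n. \<bar>R (real k / real n)\<bar> * \<bar>poly (P n k) x\<bar> * Bernstein n k x)"
      using x by (intro order_trans[OF sum_abs])
        (simp add: abs_mult mult.assoc Bernstein_nonneg)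
    also have "\<dots> \<le> (\<Sum>k\<le>n. (M * A / real n ^ (l + 4)) * (?u k ^ (2 * (l + 2)) * Bernstein n k x))"
    proof (rule sum_mono)
      fix k assume "k \<in> {..n}"
      then have k: "real k / real n \<le> 1" using n by simp
      have "\<bar>real k / real n - x\<bar> = \<bar>real k - real n * x\<bar> / real n"
      proof -
        have "real k / real n - x = (real k - real n * x) / real n"
          using n by (simp add: field_simps)
        then show ?thesis by simp
      qed
      then have "\<bar>R (real k / real n)\<bar> \<le> M * (\<bar>real k - real n * x\<bar> / real n) ^ (l + 4)"
        using R[OF _ k] by simp
      also have "\<dots> \<le> M * (?u k / real n) ^ (l + 4)"
        by (intro mult_left_mono power_mono divide_right_mono M) auto
      finally have "\<bar>R (real k / real n)\<bar> * \<bar>poly (P n k) x\<bar>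
          \<le> (M * (?u k / real n) ^ (l + 4)) * (A * ?u k ^ l)"
        using A(2)[OF n x, of k] M by (intro mult_mono) auto
      also have "\<dots> = (M * A / real n ^ (l + 4)) * (?u k ^ (l + 4) * ?u k ^ l)"
        by (simp add: power_divide)
      also have "?u k ^ (l + 4) * ?u k ^ l = ?u k ^ (2 * (l + 2))"
      proof -
        have "l + 4 + l = 2 * (l + 2)" by simp
        then show ?thesis by (simp only: power_add[symmetric])
      qed
      finally show "\<bar>R (real k / real n)\<bar> * \<bar>poly (P n k) x\<bar> * Bernstein n k x
          \<le> (M * A / real n ^ (l + 4)) * (?u k ^ (2 * (l + 2)) * Bernstein n k x)"
        using Bernstein_nonneg[OF x, of n k] by (simp only: mult.assoc[symmetric] mult_right_mono)
    qed
    also have "\<dots> \<le> (M * A / real n ^ (l + 4)) * (E * real n ^ (l + 2))"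
      unfolding sum_distrib_left[symmetric] using M A(1)
      by (intro mult_left_mono moment n x) auto
    also have "\<dots> = A * E * M / (real n)\<^sup>2"
      using n by (simp add: power_add field_simps power2_eq_square power4_eq_xxxx)
    finally have main: "(x * (1 - x)) ^ l * \<bar>poly ((pderiv ^^ l) (bern_op n R)) x\<bar>
        \<le> A * E * M / (real n)\<^sup>2" .
    have "c ^ l * \<bar>poly ((pderiv ^^ l) (bern_op n R)) x\<bar>
        \<le> (x * (1 - x)) ^ l * \<bar>poly ((pderiv ^^ l) (bern_op n R)) x\<bar>"
      using c assms by (intro mult_right_mono power_mono) auto
    with main have "c ^ l * \<bar>poly ((pderiv ^^ l) (bern_op n R)) x\<bar> \<le> A * E * M / (real n)\<^sup>2"
      by linarith
    then have "\<bar>poly ((pderiv ^^ l) (bern_op n R)) x\<bar> \<le> A * E * M / (real n)\<^sup>2 / c ^ l"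
      using assms by (simp only: pos_le_divide_eq zero_less_power mult.commute)
    then show "\<bar>poly ((pderiv ^^ l) (bern_op n R)) x\<bar> \<le> A * E / c ^ l * M / (real n)\<^sup>2"
      by (simp add: mult_ac)
  qed
qed

section \<open>Uniform Taylor expansion\<close>

lemma Cm_on_has_derivative:
  assumes "Cm_on m f S" and "k < m" and "x \<in> S"
  shows "((deriv ^^ k) f has_real_derivative (deriv ^^ Suc k) f x) (at x)"
  using assms by (simp add: Cm_on_def DERIV_deriv_iff_real_differentiable)

lemma higher_deriv_poly: "(deriv ^^ k) (poly p) = poly ((pderiv ^^ k) p)" for p :: "real poly"
proof (induction k)
  case (Suc k)
  have "deriv (poly q) = poly (pderiv q)" for q :: "real poly"
    by (rule ext) (rule DERIV_imp_deriv, rule poly_DERIV)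
  with Suc show ?case by simp
qed simp

text \<open>
  Leibniz' rule for the product with a quadratic polynomial: only three terms survive. The
  statement is used for the given function on its open set and for its Taylor
  polynomials on the whole line.
\<close>

lemma higher_deriv_variance:
  fixes f :: "real \<Rightarrow> real"
  assumes "open S" and "x \<in> S"
    and "\<And>k x. k < l + 2 \<Longrightarrow> x \<in> S \<Longrightarrow>
      ((deriv ^^ k) f has_real_derivative (deriv ^^ Suc k) f x) (at x)"
  shows "(deriv ^^ l) (\<lambda>t. t * (1 - t) * (deriv ^^ 2) f t) x
    = x * (1 - x) * (deriv ^^ (l + 2)) f x + real l * (1 - 2 * x) * (deriv ^^ (l + 1)) f x
      - real l * (real l - 1) * (deriv ^^ l) f x"
  using assms(2,3)
proof (induction l arbitrary: x)
  case 0
  then show ?case by (simp add: numeral_2_eq_2)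
next
  case (Suc l)
  let ?F = "\<lambda>k. (deriv ^^ k) f"
  let ?h = "\<lambda>x. x * (1 - x) * ?F (l + 2) x + real l * (1 - 2 * x) * ?F (l + 1) x
      - real l * (real l - 1) * ?F l x"
  have eq: "?h t = (deriv ^^ l) (\<lambda>t. t * (1 - t) * (deriv ^^ 2) f t) t" if "t \<in> S" for t
    using Suc.IH[OF that] Suc.prems(2) by simp
  have F2: "(?F (l + 2) has_real_derivative ?F (Suc l + 2) x) (at x)"
    and F1: "(?F (l + 1) has_real_derivative ?F (l + 2) x) (at x)"
    and F0: "(?F l has_real_derivative ?F (l + 1) x) (at x)"
    using Suc.prems(2)[of "l + 2" x] Suc.prems(2)[of "l + 1" x] Suc.prems(2)[of l x] Suc.prems(1)
    by auto
  have "(?h has_real_derivative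
      ((1 - 2 * x) * ?F (l + 2) x + x * (1 - x) * ?F (Suc l + 2) x
       + (real l * (1 - 2 * x) * ?F (l + 2) x - 2 * real l * ?F (l + 1) x)
       - real l * (real l - 1) * ?F (l + 1) x)) (at x)"
    by (rule derivative_eq_intros F2 F1 F0 refl)+ (simp add: algebra_simps)
  then have "((deriv ^^ l) (\<lambda>t. t * (1 - t) * (deriv ^^ 2) f t) has_real_derivative
      ((1 - 2 * x) * ?F (l + 2) x + x * (1 - x) * ?F (Suc l + 2) x
       + (real l * (1 - 2 * x) * ?F (l + 2) x - 2 * real l * ?F (l + 1) x)
       - real l * (real l - 1) * ?F (l + 1) x)) (at x)"
    by (rule has_field_derivative_transform_within_open[OF _ assms(1) Suc.prems(1) eq])
  from DERIV_imp_deriv[OF this] show ?case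
    by (simp add: algebra_simps)
qed

definition taylor_poly :: "nat \<Rightarrow> (real \<Rightarrow> real) \<Rightarrow> real \<Rightarrow> real poly" where
  "taylor_poly d f y = (\<Sum>m<d. smult ((deriv ^^ m) f y / fact m) ([:- y, 1:] ^ m))"

lemma higher_pderiv_linear_power:
  "poly ((pderiv ^^ k) ([:- y, 1:] ^ m)) y = (if k = m then fact m else 0)" for y :: real
proof (induction k arbitrary: m)
  case 0
  show ?case by (cases m) simp_all
next
  case (Suc k)
  show ?case
  proof (cases m)
    case 0
    then show ?thesis by (simp add: funpow_Suc_right del: funpow.simps)
  next
    case (Suc r)
    have "pderiv [:- y, 1:] = 1"
      by (simp add: pderiv_pCons one_pCons)
    then have "pderiv ([:- y, 1:] ^ Suc r) = smult (real (Suc r)) ([:- y, 1:] ^ r)"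
      by (simp only: pderiv_power_Suc mult_1_right)
    then show ?thesis
      using Suc.IH[of r] unfolding Suc
      by (simp only: funpow_Suc_right comp_def higher_pderiv_smult) simp
  qed
qed

lemma higher_pderiv_taylor_poly:
  assumes "k < d"
  shows "poly ((pderiv ^^ k) (taylor_poly d f y)) y = (deriv ^^ k) f y"
proof -
  have "poly ((pderiv ^^ k) (taylor_poly d f y)) y
      = (\<Sum>m<d. (deriv ^^ m) f y / fact m * (if k = m then fact m else 0))"
    by (simp only: taylor_poly_def higher_pderiv_sum higher_pderiv_smult poly_sum poly_smult
        higher_pderiv_linear_power)
  also have "\<dots> = (\<Sum>m<d. if k = m then (deriv ^^ m) f y else 0)"
    by (intro sum.cong) auto
  finally show ?thesis using assms by simp
qed

lemma poly_taylor_poly: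
  "poly (taylor_poly d f y) t = (\<Sum>m<d. (deriv ^^ m) f y / fact m * (t - y) ^ m)"
  by (simp add: taylor_poly_def poly_sum)

lemma continuous_on_compact_bound:
  fixes h :: "real \<Rightarrow> real"
  assumes "compact S" and "continuous_on S h"
  obtains A where "A \<ge> 0" and "\<And>x. x \<in> S \<Longrightarrow> \<bar>h x\<bar> \<le> A"
proof -
  have "bounded (h ` S)"
    using assms by (intro compact_imp_bounded compact_continuous_image)
  then obtain a where "\<And>x. x \<in> S \<Longrightarrow> \<bar>h x\<bar> \<le> a"
    unfolding bounded_iff by auto
  then show ?thesis
    by (intro that[of "max 0 a"]) (auto intro: max.coboundedI2)
qed

text \<open>
  Close to \<open>y\<close> the bound is Lagrange's form of the remainder, with the derivative of order
  \<open>d\<close> bounded on a compact neighbourhood of \<open>K\<close>. Away from \<open>y\<close> only boundedness of the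
  function and of the Taylor polynomials is used, because there \<open>\<bar>t - y\<bar>^d\<close> is bounded below.
\<close>

lemma uniform_taylor_remainder:
  fixes f :: "real \<Rightarrow> real"
  assumes f: "continuous_on {0..1} f" and \<Omega>: "open \<Omega>" and C: "Cm_on d f \<Omega>" and "0 < d"
    and K: "compact K" "K \<subseteq> \<Omega>" "K \<subseteq> {0..1}"
  obtains M where "M \<ge> 0"
    and "\<And>y t. y \<in> K \<Longrightarrow> 0 \<le> t \<Longrightarrow> t \<le> 1 \<Longrightarrow>
      \<bar>f t - poly (taylor_poly d f y) t\<bar> \<le> M * \<bar>t - y\<bar> ^ d"
proof -
  obtain e where e: "e > 0" and sub: "(\<Union>x\<in>K. cball x e) \<subseteq> \<Omega>"
    using compact_subset_open_imp_cball_epsilon_subset[OF K(1) \<Omega> K(2)] by blast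
  \<comment> \<open>The compact neighbourhood of \<open>K\<close> on which the highest derivative is bounded.\<close>
  define L where "L = {x + y | x y. x \<in> K \<and> y \<in> cball 0 e}"
  have "compact L"
    unfolding L_def using K(1) by (intro compact_sums) auto
  have L: "t \<in> L" if "y \<in> K" "\<bar>t - y\<bar> \<le> e" for y t
    unfolding L_def using that by (intro CollectI exI[of _ y] exI[of _ "t - y"]) (auto simp: dist_real_def)
  have "L \<subseteq> \<Omega>"
  proof
    fix t assume "t \<in> L"
    then obtain y s where "y \<in> K" "s \<in> cball 0 e" "t = y + s"
      unfolding L_def by blast
    then have "t \<in> cball y e" by (simp add: dist_real_def)
    then show "t \<in> \<Omega>" using sub \<open>y \<in> K\<close> by blast
  qed
  then have "continuous_on L ((deriv ^^ d) f)"
    using C unfolding Cm_on_def by (meson continuous_on_subset order_refl)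
  then obtain A where A: "A \<ge> 0" "\<And>x. x \<in> L \<Longrightarrow> \<bar>(deriv ^^ d) f x\<bar> \<le> A"
    using continuous_on_compact_bound[OF \<open>compact L\<close>] by metis
  obtain F where F: "F \<ge> 0" "\<And>t. t \<in> {0..1} \<Longrightarrow> \<bar>f t\<bar> \<le> F"
    using continuous_on_compact_bound[OF compact_Icc f] by metis
  have "\<exists>B\<ge>0. \<forall>y\<in>K. \<bar>(deriv ^^ m) f y\<bar> \<le> B" if "m < d" for m
  proof -
    have "continuous_on K ((deriv ^^ m) f)"
      using C that K(2) unfolding Cm_on_def by (meson continuous_on_subset less_imp_le)
    from continuous_on_compact_bound[OF K(1) this] show ?thesis by metis
  qed
  then obtain B where B: "\<And>m. m < d \<Longrightarrow> 0 \<le> B m" "\<And>m y. m < d \<Longrightarrow> y \<in> K \<Longrightarrow> \<bar>(deriv ^^ m) f y\<bar> \<le> B m"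
    by metis
  define T where "T = (\<Sum>m<d. B m)"
  have "T \<ge> 0" unfolding T_def using B(1) by (intro sum_nonneg) auto
  show ?thesis
  proof (rule that[of "A + (F + T) / e ^ d"])
    show "0 \<le> A + (F + T) / e ^ d"
      using A(1) F(1) \<open>T \<ge> 0\<close> e by simp
    fix y t :: real assume y: "y \<in> K" and t: "0 \<le> t" "t \<le> 1"
    have nonneg: "0 \<le> (F + T) / e ^ d * \<bar>t - y\<bar> ^ d" "0 \<le> A * \<bar>t - y\<bar> ^ d"
      using A(1) F(1) \<open>T \<ge> 0\<close> e by simp_all
    show "\<bar>f t - poly (taylor_poly d f y) t\<bar> \<le> (A + (F + T) / e ^ d) * \<bar>t - y\<bar> ^ d"
    proof (cases "t = y")
      case True
      have "poly (taylor_poly d f y) y = f y"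
        using higher_pderiv_taylor_poly[of 0 d f y] \<open>0 < d\<close> by simp
      then show ?thesis using True nonneg by (simp add: distrib_right)
    next
      case False
      show ?thesis
      proof (cases "\<bar>t - y\<bar> \<le> e")
        case True
        have D: "\<forall>m u. m < d \<and> min t y \<le> u \<and> u \<le> max t y \<longrightarrow>
            ((deriv ^^ m) f has_real_derivative (deriv ^^ Suc m) f u) (at u)"
        proof (intro allI impI)
          fix m u assume u: "m < d \<and> min t y \<le> u \<and> u \<le> max t y"
          then have "\<bar>u - y\<bar> \<le> e" using True by (auto simp: min_def max_def split: if_splits)
          then have "u \<in> \<Omega>" using L[OF y] \<open>L \<subseteq> \<Omega>\<close> by blast
          then show "((deriv ^^ m) f has_real_derivative (deriv ^^ Suc m) f u) (at u)"
            using Cm_on_has_derivative[OF C] u by blast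
        qed
        obtain u where u: "if t < y then t < u \<and> u < y else y < u \<and> u < t"
          and eq: "f t = (\<Sum>m<d. (deriv ^^ m) f y / fact m * (t - y) ^ m)
            + (deriv ^^ d) f u / fact d * (t - y) ^ d"
          using Taylor[OF \<open>0 < d\<close> _ D, of f y t] False by auto
        have "\<bar>u - y\<bar> \<le> e" using u True by (auto split: if_splits)
        then have "\<bar>(deriv ^^ d) f u\<bar> \<le> A" using A(2) L[OF y] by blast
        moreover have "(1::real) \<le> fact d" by (rule fact_ge_1)
        ultimately have "\<bar>(deriv ^^ d) f u\<bar> / fact d \<le> A / 1"
          by (intro frac_le) (use A(1) in auto)
        then have "\<bar>(deriv ^^ d) f u\<bar> / fact d * \<bar>t - y\<bar> ^ d \<le> A * \<bar>t - y\<bar> ^ d"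
          by (intro mult_right_mono) auto
        then have "\<bar>f t - poly (taylor_poly d f y) t\<bar> \<le> A * \<bar>t - y\<bar> ^ d"
          unfolding eq poly_taylor_poly by (simp add: abs_mult power_abs)
        then show ?thesis using nonneg by (simp add: distrib_right)
      next
        case far: False
        have "y \<in> {0..1}"
          using K(3) y by blast
        then have ty: "\<bar>t - y\<bar> \<le> 1"
          using t by auto
        have "\<bar>poly (taylor_poly d f y) t\<bar>
            \<le> (\<Sum>m<d. \<bar>(deriv ^^ m) f y / fact m * (t - y) ^ m\<bar>)"
          unfolding poly_taylor_poly by (rule sum_abs)
        also have "\<dots> \<le> T"
          unfolding T_def
        proof (rule sum_mono)
          fix m assume "m \<in> {..<d}"
          then have m: "m < d" by simp
          have "\<bar>(deriv ^^ m) f y\<bar> / fact m \<le> B m / 1"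
            by (intro frac_le B m y) (use fact_ge_1 in auto)
          then have "\<bar>(deriv ^^ m) f y\<bar> / fact m * \<bar>t - y\<bar> ^ m \<le> B m * 1"
            using ty B(1)[OF m] by (intro mult_mono power_le_one) auto
          then show "\<bar>(deriv ^^ m) f y / fact m * (t - y) ^ m\<bar> \<le> B m"
            by (simp add: abs_mult power_abs)
        qed
        finally have "\<bar>f t - poly (taylor_poly d f y) t\<bar> \<le> (F + T) / e ^ d * e ^ d"
          using F(2)[of t] t e by auto
        also have "\<dots> \<le> (F + T) / e ^ d * \<bar>t - y\<bar> ^ d"
          using far e F(1) \<open>T \<ge> 0\<close> by (intro mult_left_mono power_mono) auto
        finally show ?thesis using nonneg by (simp add: distrib_right)
      qed
    qed
  qed
qed

section \<open>The uniform expansion and its consequences\<close>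

text \<open>
  At each point \<open>x\<close> of \<open>K\<close> the function is the sum of its Taylor polynomial there and of a
  remainder that vanishes to order \<open>l + 4\<close>. The polynomial part yields the
  two leading terms, because the Taylor polynomial has the same derivatives up to order \<open>l + 3\<close> at
  \<open>x\<close>; its defect and the remainder are both of size \<open>1/n\<^sup>2\<close>, uniformly in \<open>x\<close>.
\<close>

lemma bernstein_derivative_expansion:
  fixes f :: "real \<Rightarrow> real"
  assumes f: "continuous_on {0..1} f" and \<Omega>: "open \<Omega>" "\<Omega> \<subseteq> {0<..<1}"
    and C: "Cm_on (l + 4) f \<Omega>" and K: "compact K" "K \<subseteq> \<Omega>"
  obtains C where "C > 0" and "\<And>x n. x \<in> K \<Longrightarrow> 1 \<le> n \<Longrightarrow>
    \<bar>(deriv ^^ l) (Bernstein_poly n f) x - (deriv ^^ l) f x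
      - 1 / (2 * real n) * (deriv ^^ l) (\<lambda>t. t * (1 - t) * (deriv ^^ 2) f t) x\<bar>
    \<le> C / (real n)\<^sup>2"
proof -
  have K01: "K \<subseteq> {0..1}" using K(2) \<Omega>(2) by fastforce
  have "\<exists>c>0. \<forall>x\<in>K. c \<le> x * (1 - x)"
  proof (cases "K = {}")
    case True
    then show ?thesis by (auto intro: exI[of _ 1])
  next
    case False
    have "continuous_on K (\<lambda>x::real. x * (1 - x))" by (intro continuous_intros)
    then obtain a where a: "a \<in> K" "\<And>x. x \<in> K \<Longrightarrow> a * (1 - a) \<le> x * (1 - x)"
      using continuous_attains_inf[OF K(1) False] by blast
    have "0 < a" "a < 1" using a(1) K(2) \<Omega>(2) by auto
    with a(2) show ?thesis by (intro exI[of _ "a * (1 - a)"]) auto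
  qed
  then obtain c where c: "c > 0" "\<And>x. x \<in> K \<Longrightarrow> c \<le> x * (1 - x)" by blast
  let ?T = "taylor_poly (l + 4) f"
  obtain M where M: "M \<ge> 0" "\<And>y t. y \<in> K \<Longrightarrow> 0 \<le> t \<Longrightarrow> t \<le> 1 \<Longrightarrow>
      \<bar>f t - poly (?T y) t\<bar> \<le> M * \<bar>t - y\<bar> ^ (l + 4)"
    by (rule uniform_taylor_remainder[OF f \<Omega>(1) C _ K K01]) auto
  obtain R where R: "R \<ge> 0" "\<And>n g x M. 1 \<le> n \<Longrightarrow> 0 \<le> x \<Longrightarrow> x \<le> 1 \<Longrightarrow>
      c \<le> x * (1 - x) \<Longrightarrow> 0 \<le> M \<Longrightarrow>
      (\<And>t. 0 \<le> t \<Longrightarrow> t \<le> 1 \<Longrightarrow> \<bar>g t\<bar> \<le> M * \<bar>t - x\<bar> ^ (l + 4)) \<Longrightarrow>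
      \<bar>poly ((pderiv ^^ l) (bern_op n g)) x\<bar> \<le> R * M / (real n)\<^sup>2"
    by (rule remainder_estimate[OF c(1), of l]) blast
  have "\<exists>B. \<forall>y\<in>K. \<bar>(deriv ^^ m) f y / fact m\<bar> \<le> B" if "m < l + 4" for m
  proof -
    have "continuous_on K ((deriv ^^ m) f)"
      using C that K(2) unfolding Cm_on_def by (meson continuous_on_subset less_imp_le)
    then have "continuous_on K (\<lambda>y. (deriv ^^ m) f y / fact m)"
      by (intro continuous_intros) auto
    from continuous_on_compact_bound[OF K(1) this] show ?thesis by metis
  qed
  then obtain B where B: "\<And>m y. m < l + 4 \<Longrightarrow> y \<in> K \<Longrightarrow> \<bar>(deriv ^^ m) f y / fact m\<bar> \<le> B m"
    by metis
  obtain V where V: "\<And>n y x. 1 \<le> n \<Longrightarrow> y \<in> K \<Longrightarrow> \<bar>x\<bar> \<le> 1 \<Longrightarrow>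
      \<bar>poly ((pderiv ^^ l) (voronovskaya_defect n (?T y))) x\<bar> \<le> V / (real n)\<^sup>2"
    unfolding taylor_poly_def
    by (rule voronovskaya_bounded_coefficients[of "l + 4" K
          "\<lambda>m y. (deriv ^^ m) f y / fact m" B l, OF B K01]) blast+
  show ?thesis
  proof (rule that[of "\<bar>V\<bar> + R * M + 1"])
    show "0 < \<bar>V\<bar> + R * M + 1" using R(1) M(1) by (simp add: add_nonneg_pos)
    fix x n assume x: "x \<in> K" and n: "1 \<le> (n::nat)"
    have x01: "0 \<le> x" "x \<le> 1" using x K01 by auto
    let ?g = "\<lambda>t. f t - poly (?T x) t"
    have jet: "poly ((pderiv ^^ k) (?T x)) x = (deriv ^^ k) f x" if "k < l + 4" for k
      using higher_pderiv_taylor_poly[OF that] .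
    have "bern_op n f = bern_op n (poly (?T x)) + bern_op n ?g"
      unfolding bern_op_add[symmetric] by simp
    also have "bern_op n (poly (?T x)) = ?T x
        + smult (1 / (2 * real n)) (variance_poly * pderiv (pderiv (?T x)))
        + voronovskaya_defect n (?T x)"
      by (simp add: voronovskaya_defect_def)
    finally have split: "(deriv ^^ l) (Bernstein_poly n f) x = (deriv ^^ l) f x
        + 1 / (2 * real n) * poly ((pderiv ^^ l) (variance_poly * pderiv (pderiv (?T x)))) x
        + poly ((pderiv ^^ l) (voronovskaya_defect n (?T x))) x
        + poly ((pderiv ^^ l) (bern_op n ?g)) x"
      by (simp add: Bernstein_poly_eq_poly higher_deriv_poly higher_pderiv_add
          higher_pderiv_smult jet)
    have main: "poly ((pderiv ^^ l) (variance_poly * pderiv (pderiv (?T x)))) x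
        = (deriv ^^ l) (\<lambda>t. t * (1 - t) * (deriv ^^ 2) f t) x"
    proof -
      have "poly (variance_poly * pderiv (pderiv (?T x)))
          = (\<lambda>t. t * (1 - t) * (deriv ^^ 2) (poly (?T x)) t)"
        unfolding higher_deriv_poly by (simp add: fun_eq_iff poly_variance_poly numeral_2_eq_2)
      then have "poly ((pderiv ^^ l) (variance_poly * pderiv (pderiv (?T x)))) x
          = (deriv ^^ l) (\<lambda>t. t * (1 - t) * (deriv ^^ 2) (poly (?T x)) t) x"
        unfolding higher_deriv_poly[symmetric] by (rule arg_cong)
      also have "\<dots> = x * (1 - x) * (deriv ^^ (l + 2)) f x
          + real l * (1 - 2 * x) * (deriv ^^ (l + 1)) f x - real l * (real l - 1) * (deriv ^^ l) f x"
      proof -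
        have "((deriv ^^ k) (poly (?T x)) has_real_derivative (deriv ^^ Suc k) (poly (?T x)) u) (at u)"
          for k u
          unfolding higher_deriv_poly by simp
        moreover have "(deriv ^^ k) (poly (?T x)) x = (deriv ^^ k) f x" if "k < l + 4" for k
          unfolding higher_deriv_poly by (rule jet[OF that])
        ultimately show ?thesis
          using higher_deriv_variance[of UNIV x l "poly (?T x)"] by (simp del: funpow.simps)
      qed
      also have "\<dots> = (deriv ^^ l) (\<lambda>t. t * (1 - t) * (deriv ^^ 2) f t) x"
        using x K(2) Cm_on_has_derivative[OF C]
        by (intro higher_deriv_variance[OF \<Omega>(1), symmetric]) auto
      finally show ?thesis .
    qed
    have "\<bar>poly ((pderiv ^^ l) (voronovskaya_defect n (?T x))) x\<bar> \<le> V / (real n)\<^sup>2"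
      using V[OF n x, of x] x01 by auto
    also have "\<dots> \<le> \<bar>V\<bar> / (real n)\<^sup>2"
      by (intro divide_right_mono) auto
    finally have defect: "\<bar>poly ((pderiv ^^ l) (voronovskaya_defect n (?T x))) x\<bar>
        \<le> \<bar>V\<bar> / (real n)\<^sup>2" .
    have remainder: "\<bar>poly ((pderiv ^^ l) (bern_op n ?g)) x\<bar> \<le> R * M / (real n)\<^sup>2"
      by (rule R(2)[OF n x01 c(2)[OF x] M]) (use x in auto)
    have "\<bar>(deriv ^^ l) (Bernstein_poly n f) x - (deriv ^^ l) f x
      - 1 / (2 * real n) * (deriv ^^ l) (\<lambda>t. t * (1 - t) * (deriv ^^ 2) f t) x\<bar>
      \<le> \<bar>V\<bar> / (real n)\<^sup>2 + R * M / (real n)\<^sup>2"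
      unfolding split main using defect remainder by linarith
    also have "\<dots> \<le> (\<bar>V\<bar> + R * M + 1) / (real n)\<^sup>2"
      by (simp add: add_divide_distrib)
    finally show "\<bar>(deriv ^^ l) (Bernstein_poly n f) x - (deriv ^^ l) f x
      - 1 / (2 * real n) * (deriv ^^ l) (\<lambda>t. t * (1 - t) * (deriv ^^ 2) f t) x\<bar>
      \<le> (\<bar>V\<bar> + R * M + 1) / (real n)\<^sup>2" .
  qed
qed

lemma abs_le_max_norm_on:
  assumes "compact K" and "continuous_on K h" and "x \<in> K"
  shows "\<bar>h x\<bar> \<le> max_norm_on K h"
proof -
  obtain A where "\<And>x. x \<in> K \<Longrightarrow> \<bar>h x\<bar> \<le> A"
    using continuous_on_compact_bound[OF assms(1,2)] by metis
  then show ?thesis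
    unfolding max_norm_on_def using assms(3) by (intro cSUP_upper bdd_aboveI2) auto
qed

theorem theorem2p9:
  fixes l :: nat and f :: "real \<Rightarrow> real" and \<Omega> K :: "real set"
  assumes "continuous_on {0..1} f"
    and "open \<Omega>" and "\<Omega> \<subseteq> {0<..<1}"
    and "Cm_on (l + 4) f \<Omega>"
    and "compact K" and "K \<subseteq> \<Omega>"
  shows "(\<exists>C>0. \<forall>x\<in>K. \<forall>\<nu>::nat. \<nu> \<ge> 1 \<longrightarrow>
            \<bar>(deriv ^^ l) (Bernstein_poly \<nu> f) x - (deriv ^^ l) f x\<bar>
            \<le> 1 / (2 * real \<nu>) *
                (real l * (real l - 1) *
                    (\<Sum>k=l..l+3. max_norm_on K ((deriv ^^ k) f) / fact (k - l))
                 + real l * \<bar>1 - 2 * x\<bar> *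
                    (\<Sum>k=l+1..l+3. max_norm_on K ((deriv ^^ k) f) / fact (k - l - 1))
                 + x * (1 - x) *
                    (\<Sum>k=l+2..l+3. max_norm_on K ((deriv ^^ k) f) / fact (k - l - 2)))
              + C / (real \<nu>)\<^sup>2)
       \<and> (\<forall>\<epsilon>>0. \<exists>C>0. \<forall>x\<in>K. \<forall>\<nu>::nat. \<nu> > l \<longrightarrow>
            \<bar>real \<nu> * ((deriv ^^ l) (Bernstein_poly \<nu> f) x - (deriv ^^ l) f x)
              - 1 / 2 * (deriv ^^ l) (\<lambda>t. t * (1 - t) * (deriv ^^ 2) f t) x\<bar>
            < \<epsilon> + C / real \<nu>)"
    (is "?first \<and> ?second")
proof -
  let ?D = "(deriv ^^ l) (\<lambda>t. t * (1 - t) * (deriv ^^ 2) f t)"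
  obtain C where C: "C > 0" and expansion: "\<And>x n. x \<in> K \<Longrightarrow> 1 \<le> n \<Longrightarrow>
      \<bar>(deriv ^^ l) (Bernstein_poly n f) x - (deriv ^^ l) f x - 1 / (2 * real n) * ?D x\<bar>
      \<le> C / (real n)\<^sup>2"
    by (rule bernstein_derivative_expansion[OF assms]) blast
  let ?N = "\<lambda>k. max_norm_on K ((deriv ^^ k) f)"
  have norm: "\<bar>(deriv ^^ k) f x\<bar> \<le> ?N k" if "x \<in> K" "k \<le> l + 4" for k x
  proof (rule abs_le_max_norm_on[OF assms(5) _ that(1)])
    show "continuous_on K ((deriv ^^ k) f)"
      using assms(4,6) that(2) unfolding Cm_on_def by (meson continuous_on_subset)
  qed
  have leading: "?N m \<le> (\<Sum>k=m..l+3. ?N k / fact (k - m))" if "x \<in> K" "m \<le> l + 3" for m x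
  proof -
    have "?N m / fact (m - m) \<le> (\<Sum>k=m..l+3. ?N k / fact (k - m))"
    proof (rule member_le_sum)
      fix k assume "k \<in> {m..l+3} - {m}"
      then have "0 \<le> ?N k" using norm[OF that(1), of k] by simp
      then show "0 \<le> ?N k / fact (k - m)" by simp
    qed (use that in auto)
    then show ?thesis by simp
  qed
  \<comment> \<open>Up to the factor \<open>1 / (2 n)\<close>, the three terms of the derivative of order \<open>l\<close> of
    \<open>t (1 - t) f''(t)\<close> are dominated by the first summands of the three sums.\<close>
  have ?first
  proof (intro exI[of _ C] conjI C ballI allI impI)
    fix x and n :: nat assume x: "x \<in> K" and n: "1 \<le> n"
    have x01: "0 \<le> x * (1 - x)" using x assms(3,6) by fastforce
    have ll: "0 \<le> real l * (real l - 1)" by (cases l) simp_all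
    have D_eq: "?D x = x * (1 - x) * (deriv ^^ (l + 2)) f x
        + real l * (1 - 2 * x) * (deriv ^^ (l + 1)) f x - real l * (real l - 1) * (deriv ^^ l) f x"
      using x assms(6) Cm_on_has_derivative[OF assms(4)]
      by (intro higher_deriv_variance[OF assms(2)]) auto
    have "\<bar>?D x\<bar> \<le> real l * (real l - 1) * \<bar>(deriv ^^ l) f x\<bar>
        + real l * \<bar>1 - 2 * x\<bar> * \<bar>(deriv ^^ (l + 1)) f x\<bar>
        + x * (1 - x) * \<bar>(deriv ^^ (l + 2)) f x\<bar>"
    proof -
      have "\<bar>a + b - c\<bar> \<le> \<bar>c\<bar> + \<bar>b\<bar> + \<bar>a\<bar>" for a b c :: real
        by linarith
      moreover have "\<bar>x * (1 - x) * u\<bar> = x * (1 - x) * \<bar>u\<bar>"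
        and "\<bar>real l * (1 - 2 * x) * u\<bar> = real l * \<bar>1 - 2 * x\<bar> * \<bar>u\<bar>"
        and "\<bar>real l * (real l - 1) * u\<bar> = real l * (real l - 1) * \<bar>u\<bar>" for u
        by (simp_all only: abs_mult[of _ u] abs_mult[of _ "1 - 2 * x"] abs_of_nonneg[OF x01]
            abs_of_nonneg[OF ll] abs_of_nat)
      ultimately show ?thesis
        unfolding D_eq by metis
    qed
    also have "\<dots> \<le> real l * (real l - 1) * (\<Sum>k=l..l+3. ?N k / fact (k - l))
        + real l * \<bar>1 - 2 * x\<bar> * (\<Sum>k=l+1..l+3. ?N k / fact (k - (l + 1)))
        + x * (1 - x) * (\<Sum>k=l+2..l+3. ?N k / fact (k - (l + 2)))"
      using ll x01
      by (intro add_mono mult_left_mono order_trans[OF norm[OF x] leading[OF x]]) auto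
    finally have D: "\<bar>?D x\<bar> \<le> \<dots>" .
    let ?S = "real l * (real l - 1) * (\<Sum>k=l..l+3. ?N k / fact (k - l))
        + real l * \<bar>1 - 2 * x\<bar> * (\<Sum>k=l+1..l+3. ?N k / fact (k - l - 1))
        + x * (1 - x) * (\<Sum>k=l+2..l+3. ?N k / fact (k - l - 2))"
    have "\<bar>?D x\<bar> \<le> ?S" using D by (simp only: diff_diff_left)
    then have "\<bar>1 / (2 * real n) * ?D x\<bar> \<le> 1 / (2 * real n) * ?S"
      unfolding abs_mult by (intro mult_mono) auto
    then show "\<bar>(deriv ^^ l) (Bernstein_poly n f) x - (deriv ^^ l) f x\<bar>
        \<le> 1 / (2 * real n) * ?S + C / (real n)\<^sup>2"
      using expansion[OF x n] by linarith
  qed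
  moreover have ?second
  proof (intro allI impI exI[of _ C] conjI C ballI)
    fix \<epsilon> x :: real and n :: nat assume \<epsilon>: "0 < \<epsilon>" and x: "x \<in> K" and "l < n"
    then have n: "1 \<le> n" by simp
    let ?E = "(deriv ^^ l) (Bernstein_poly n f) x - (deriv ^^ l) f x"
    have "real n * ?E - 1 / 2 * ?D x = real n * (?E - 1 / (2 * real n) * ?D x)"
      using n by (simp add: field_simps)
    then have "\<bar>real n * ?E - 1 / 2 * ?D x\<bar> = real n * \<bar>?E - 1 / (2 * real n) * ?D x\<bar>"
      by (simp add: abs_mult)
    also have "\<dots> \<le> real n * (C / (real n)\<^sup>2)"
      using expansion[OF x n] by (intro mult_left_mono) auto
    also have "\<dots> = C / real n"
      using n by (simp add: power2_eq_square)
    finally show "\<bar>real n * ?E - 1 / 2 * ?D x\<bar> < \<epsilon> + C / real n"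
      using \<epsilon> by linarith
  qed
  ultimately show ?thesis ..
qed

end
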